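(* Let $\alpha\in(0,2)$ and let $\sigma:\mathbb{R}\to\mathbb{R}$ satisfy $|\sigma(\cdot)|^\alpha\in C^2(\mathbb{R})$, $\sigma(x)\neq0$ for all $x$, and $|\sigma(x)|\le\widetilde M$ for a constant $\widetilde M$. Let $J\in\mathbb{N}$, $h=1/J$, $x_j=jh$, $\Delta t>0$, $c(x)=c(1,\alpha)|\sigma(x)|^\alpha$, and consider the explicit Euler scheme with absorbing boundary condition (with $f=g=0$): $U_j^n=0$ for $|j|\ge J$, and for $|j|<J$, $n\ge0$, $$U_j^{n+1}=U_j^n-\Delta t\,c(x_j)\zeta(\alpha-1)h^{-\alpha}\big(U_{j+1}^n-2U_j^n+U_{j-1}^n\big)-\frac{c(x_j)\Delta t}{\alpha}\Big[\frac1{(1+x_j)^\alpha}+\frac1{(1-x_j)^\alpha}\Big]U_j^n+c(x_j)\Delta t\,h\sum_{k=-J-j,\,k\ne0}^{J-j}\frac{U_{j+k}^n-U_j^n}{|x_k|^{1+\alpha}} .$$ If $$\frac{\Delta t}{h^\alpha}\le\frac{1}{2\widetilde M^\alpha c(1,\alpha)\big[1+\frac1\alpha-\zeta(\alpha-1)\big]},$$ then the scheme satisfies the discrete maximum principle: with $M$ the maximum of the initial data, if $0<U_j^n\le M$ for all $|j|<J$, then $U_j^{n+1}\le M$ for all $|j|<J$.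
   Context: $c(1,\alpha)=\dfrac{\alpha\Gamma((1+\alpha)/2)}{2^{1-\alpha}\pi^{1/2}\Gamma(1-\alpha/2)}$; $\zeta$ is the Riemann zeta function (analytically continued). In the sum $\sum_{k=-J-j,k\neq 0}^{J-j}$, the terms of both end indices $k=-J-j$ and $k=J-j$ are multiplied by $\frac12$. The scheme discretizes $u_t(x,t)=c(1,\alpha)|\sigma(x)|^\alpha\,\mathrm{P.V.}\int_{\mathbb{R}\setminus\{0\}}\frac{u(x+z,t)-u(x,t)}{|z|^{1+\alpha}}dz$ on $(-1,1)$ with $u(x,t)=0$ for $x\notin(-1,1)$; here $u=|\sigma|^\alpha p$, where $p$ solves the Fokker-Planck equation of $dX_t=\sigma(X_{t-})dL_t^\alpha$. *)

theory Defs
  imports "HOL-Complex_Analysis.Complex_Analysis"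
begin

(* The Riemann zeta function. Its value at s is read off from any holomorphic continuation
   of the Dirichlet series to a half-plane around s punctured at the pole 1. By the identity
   theorem the value depends neither on the half-plane nor on the continuation (zeta_eqI).
   The value at s = 1 is unspecified. *)
definition zeta_continuation :: "real \<Rightarrow> (complex \<Rightarrow> complex) \<Rightarrow> bool" where
  "zeta_continuation a f \<longleftrightarrow>
     f holomorphic_on ({z. a < Re z} - {1}) \<and>
     (\<forall>z. a < Re z \<and> 1 < Re z \<longrightarrow> (\<lambda>n. 1 / of_nat (Suc n) powr z) sums f z)"

definition zeta :: "complex \<Rightarrow> complex" where
  "zeta s = (THE w. \<exists>a f. a < Re s \<and> zeta_continuation a f \<and> f s = w)"

lemma zeta_continuation_unique:
  assumes "zeta_continuation a f" "zeta_continuation b g" "a < Re s" "b < Re s" "s \<noteq> 1"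
  shows "f s = g s"
proof -
  define S where "S = {z. max a b < Re z} - {1::complex}"
  define P where "P = {z. max (max a b) 1 < Re z}"
  have S: "open S" "connected S"
    unfolding S_def
    by (intro open_delete open_halfspace_Re_gt connected_open_delete convex_connected
        convex_halfspace_Re_gt; simp)+
  have P: "open P"
    unfolding P_def by (rule open_halfspace_Re_gt)
  have "complex_of_real (max (max a b) 1 + 1) \<in> P"
    unfolding P_def by (simp add: max_def)
  then have "P \<noteq> {}" by blast
  moreover have "P \<subseteq> S" by (auto simp: P_def S_def)
  moreover have "f holomorphic_on S" "g holomorphic_on S"
    using assms(1,2) unfolding zeta_continuation_def S_def
    by (auto elim!: holomorphic_on_subset)
  moreover have "f z = g z" if "z \<in> P" for z
    using assms(1,2) that unfolding zeta_continuation_def P_def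
    by (auto intro: sums_unique2)
  moreover have "s \<in> S" using assms by (simp add: S_def)
  ultimately show ?thesis
    using analytic_continuation_open[of P S f g s] S P by blast
qed

lemma zeta_eqI:
  assumes "zeta_continuation a f" "a < Re s" "s \<noteq> 1"
  shows "zeta s = f s"
  unfolding zeta_def
  using assms zeta_continuation_unique by (intro the_equality) blast+

definition c1 :: "real \<Rightarrow> real" where
  "c1 \<alpha> = \<alpha> * Gamma ((1 + \<alpha>) / 2) /
            (2 powr (1 - \<alpha>) * pi powr (1 / 2) * Gamma (1 - \<alpha> / 2))"

definition C2 :: "(real \<Rightarrow> real) \<Rightarrow> bool" where
  "C2 f \<longleftrightarrow> (\<exists>f' f''. (\<forall>x. (f has_real_derivative f' x) (at x)) \<and>
                       (\<forall>x. (f' has_real_derivative f'' x) (at x)) \<and>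
                       continuous_on UNIV f'')"

definition end_weight :: "nat \<Rightarrow> int \<Rightarrow> int \<Rightarrow> real" where
  "end_weight J j k = (if k = - int J - j \<or> k = int J - j then 1 / 2 else 1)"

(* U n j is the numerical solution at time n * dt and grid point j / J. Since zeta is real
   on the real axis away from 1, Re only converts the type. *)
definition euler_scheme ::
  "real \<Rightarrow> (real \<Rightarrow> real) \<Rightarrow> nat \<Rightarrow> real \<Rightarrow> (nat \<Rightarrow> int \<Rightarrow> real) \<Rightarrow> bool" where
  "euler_scheme \<alpha> \<sigma> J dt U \<longleftrightarrow>
     (let h = 1 / real J;
          x = (\<lambda>j::int. of_int j * h);
          c = (\<lambda>y. c1 \<alpha> * \<bar>\<sigma> y\<bar> powr \<alpha>)
      in (\<forall>n j. int J \<le> \<bar>j\<bar> \<longrightarrow> U n j = 0) \<and>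
         (\<forall>n j. \<bar>j\<bar> < int J \<longrightarrow>
            U (Suc n) j =
              U n j
              - dt * c (x j) * Re (zeta (of_real (\<alpha> - 1))) * h powr (- \<alpha>) *
                  (U n (j + 1) - 2 * U n j + U n (j - 1))
              - c (x j) * dt / \<alpha> *
                  (1 / (1 + x j) powr \<alpha> + 1 / (1 - x j) powr \<alpha>) * U n j
              + c (x j) * dt * h *
                  (\<Sum>k \<in> {- int J - j .. int J - j} - {0}.
                     end_weight J j k * ((U n (j + k) - U n j) / \<bar>x k\<bar> powr (1 + \<alpha>)))))"

end

theory Submission
  imports Defs
begin

text \<open>
  The new value is a combination of the old ones in which, apart from that of \<open>U n j\<close>, all
  coefficients are nonnegative because \<open>\<zeta>(\<alpha> - 1) \<le> 0\<close>. Hence \<open>U (Suc n) j \<le> U n j + D (M - U n j)\<close>,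
  and \<open>D \<le> 1\<close> by the step size condition and a comparison of \<open>\<Sum> 1 / k\<^sup>1\<^sup>+\<^sup>\<alpha>\<close> with an integral.

  The sign of zeta comes from its continuation to \<open>Re s > -1\<close> by the trapezoidal rule,
  \<open>\<zeta>(s) = 1/2 + 1/(s - 1) + \<Sum>n T\<^sub>n(s)\<close>, where \<open>T\<^sub>n\<close> is the error of the rule for \<open>x powr (- s)\<close> on
  \<open>[n, n + 1]\<close>, of size \<open>O(n powr (- Re s - 2))\<close>. For \<open>-1 < s \<le> 0\<close> concavity gives \<open>T\<^sub>n \<le> 0\<close>; for
  \<open>0 < s < 1\<close> monotonicity bounds \<open>T\<^sub>n\<close> by a telescoping series with sum \<open>1/2\<close>.
\<close>

section \<open>Continuation of zeta to the half-plane Re s > -1\<close>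

definition trapezoid_error :: "real \<Rightarrow> complex \<Rightarrow> complex" where
  "trapezoid_error a s =
     (of_real a powr (- s) + of_real (a + 1) powr (- s)) / 2
     - (of_real (a + 1) powr (1 - s) - of_real a powr (1 - s)) / (1 - s)"

text \<open>For Re s > 1, summing the trapezoidal rule over all \<open>[n, n + 1]\<close> with n
  \<ge> 1 counts the endpoint 1 only half, hence the \<open>1 / 2\<close>;
  \<open>1 / (s - 1)\<close> is the integral of \<open>x powr (- s)\<close> from 1 to
  infinity.\<close>

definition zeta_aux :: "complex \<Rightarrow> complex" where
  "zeta_aux s = 1 / 2 + 1 / (s - 1) + (\<Sum>n. trapezoid_error (real (Suc n)) s)"

text \<open>Regard the error on \<open>[a, z]\<close> as a function \<open>f z\<close> of the right
  endpoint. The first-order terms cancel in its second derivative, and both \<open>f\<close> and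
  \<open>f'\<close> vanish at \<open>a\<close>. So a bound on \<open>f''\<close> passes to
  \<open>f'\<close> and then to \<open>f\<close> along a segment of length 1. Since s is complex,
  norm estimates on the real segment, embedded in the complex plane, replace the mean value
  theorem.\<close>

lemma norm_trapezoid_error_le:
  assumes a: "1 \<le> a" and s: "- 1 \<le> Re s" "s \<noteq> 1"
  shows "norm (trapezoid_error a s) \<le> norm s * norm (s + 1) / 2 * a powr (- Re s - 2)"
proof -
  define S where "S = closed_segment (complex_of_real a) (of_real (a + 1))"
  define B where "B = norm s * norm (s + 1) / 2 * a powr (- Re s - 2)"
  define A where "A = complex_of_real a"
  define f where
    "f z = (z - A) * (A powr (- s) + z powr (- s)) / 2
             - (z powr (1 - s) - A powr (1 - s)) / (1 - s)" for z
  define f' where "f' z = (A powr (- s) - z powr (- s)) / 2 + (z - A) * (- s * z powr (- s - 1)) / 2" for z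
  define f'' where "f'' z = (z - A) * (s * (s + 1) * z powr (- s - 2)) / 2" for z
  have S_iff: "z \<in> S \<longleftrightarrow> (\<exists>x. z = of_real x \<and> a \<le> x \<and> x \<le> a + 1)" for z
    unfolding S_def closed_segment_of_real closed_segment_eq_real_ivl by auto
  have S_pos: "z \<notin> \<real>\<^sub>\<le>\<^sub>0" if "z \<in> S" for z
    using that a by (auto simp: S_iff)
  have S_dist: "norm (z - A) \<le> 1" if z: "z \<in> S" for z
  proof -
    obtain x where x: "z = of_real x" "a \<le> x" "x \<le> a + 1" using S_iff[THEN iffD1, OF z] by blast
    have "z - A = of_real (x - a)" by (simp add: x A_def)
    then show ?thesis using x by (simp add: norm_of_real del: of_real_diff)
  qed
  have conv: "convex S" by (simp add: S_def)
  have B0: "0 \<le> B" by (simp add: B_def)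
  have s1: "1 - s \<noteq> 0" using s by auto
  have df: "(f has_field_derivative f' z) (at z within S)" if "z \<in> S" for z
  proof -
    have pos: "z \<notin> \<real>\<^sub>\<le>\<^sub>0" by (rule S_pos[OF that])
    have F: "((\<lambda>z. (z powr (1 - s) - A powr (1 - s)) / (1 - s)) has_field_derivative z powr (- s)) (at z)"
      using DERIV_cdivide[where c = "1 - s",
          OF DERIV_diff[OF has_field_derivative_powr[OF pos, of "1 - s"] DERIV_const[of "A powr (1 - s)"]]] s1
      by simp
    have "((\<lambda>z. (z - A) * (A powr (- s) + z powr (- s)) / 2) has_field_derivative f' z + z powr (- s)) (at z)"
      unfolding f'_def using pos
      by (auto intro!: derivative_eq_intros has_field_derivative_powr simp: field_simps)
    from DERIV_diff[OF this F] show ?thesis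
      unfolding f_def by (simp add: has_field_derivative_at_within)
  qed
  have df': "(f' has_field_derivative f'' z) (at z within S)" if "z \<in> S" for z
    unfolding f'_def f''_def using S_pos[OF that]
    by (auto intro!: derivative_eq_intros has_field_derivative_powr[THEN has_field_derivative_at_within]
        simp: field_simps)
  have bd: "norm (f'' z) \<le> B" if z: "z \<in> S" for z
  proof -
    obtain x where x: "z = of_real x" "a \<le> x" "x \<le> a + 1" using S_iff[THEN iffD1, OF z] by blast
    have "norm (f'' z) = norm (z - A) * (norm s * norm (s + 1) / 2 * x powr (- Re s - 2))"
      using x a by (simp add: f''_def norm_mult norm_divide norm_powr_real_powr)
    \<comment> \<open>The exponent \<open>- Re s - 2\<close> is negative, so the power is largest at
      the left endpoint \<open>a\<close>.\<close>
    also have "\<dots> \<le> 1 * (norm s * norm (s + 1) / 2 * a powr (- Re s - 2))"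
      using x a s by (intro mult_mono S_dist z powr_mono2') auto
    finally show ?thesis by (simp add: B_def)
  qed
  have aS: "A \<in> S" "A + 1 \<in> S" by (simp_all add: S_def A_def)
  have bd': "norm (f' z) \<le> B" if z: "z \<in> S" for z
  proof -
    have "norm (f' z - f' A) \<le> B * norm (z - A)"
      by (rule field_differentiable_bound[OF conv df' bd]) (use z aS in auto)
    also have "\<dots> \<le> B * 1" by (intro mult_left_mono S_dist z B0)
    finally show ?thesis by (simp add: f'_def)
  qed
  have "norm (f (A + 1) - f A) \<le> B * norm (A + 1 - A)"
    by (rule field_differentiable_bound[OF conv df bd']) (use aS in auto)
  also have "f (A + 1) - f A = trapezoid_error a s"
    by (simp add: f_def trapezoid_error_def A_def)
  finally show ?thesis by (simp add: B_def)
qed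

lemma trapezoid_error_series:
  shows "zeta_aux holomorphic_on {z. -1 < Re z} - {1}"
    and "\<And>s. -1 < Re s \<Longrightarrow> s \<noteq> 1 \<Longrightarrow> summable (\<lambda>n. trapezoid_error (real (Suc n)) s)"
proof -
  define S where "S = {z. -1 < Re z} - {1::complex}"
  have "open S" unfolding S_def by (intro open_delete open_halfspace_Re_gt)
  obtain g where g: "\<forall>x\<in>S. (\<lambda>n. trapezoid_error (real (Suc n)) x) sums g x \<and> g field_differentiable at x"
  proof (rule series_differentiable_comparison_complex[OF \<open>open S\<close>])
    fix n x assume "x \<in> S"
    show "trapezoid_error (real (Suc n)) field_differentiable at x"
      unfolding trapezoid_error_def[abs_def] using \<open>x \<in> S\<close>
      by (intro holomorphic_on_imp_differentiable_at[of _ "- {1}"] holomorphic_on_diff holomorphic_on_add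
          holomorphic_on_divide holomorphic_on_powr_right holomorphic_on_minus holomorphic_on_ident
          holomorphic_on_const)
         (auto simp: S_def simp del: of_real_of_nat_eq of_real_add of_nat_Suc)
  next
    fix x assume x: "x \<in> S"
    \<comment> \<open>With d half the distance from x to the line Re s = -1, every y in the ball
      satisfies \<open>Re y \<ge> d - 1\<close>. Hence \<open>- Re y - 2 \<le> - 1 - d\<close>, an
      exponent below -1, and one summable majorant serves the whole ball.\<close>
    define d where "d = (Re x + 1) / 2"
    define R where "R = norm x + d"
    define h where "h n = complex_of_real (R * (R + 1) / 2 * real (Suc n) powr (- 1 - d))" for n
    have d: "0 < d" using x by (simp add: d_def S_def)
    then have R: "0 \<le> R" by (simp add: R_def)
    have "summable h"
      unfolding h_def summable_complex_of_real using d
      by (intro summable_mult) (subst summable_Suc_iff, simp add: summable_real_powr_iff)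
    moreover have "range h \<subseteq> \<real>\<^sub>\<ge>\<^sub>0" using R by (auto simp: h_def)
    moreover have "norm (trapezoid_error (real (Suc n)) y) \<le> norm (h n)" if y: "y \<in> ball x d \<inter> S" for y n
    proof -
      have "norm (x - y) < d" using y by (simp add: dist_norm)
      then have ny: "norm y \<le> R" "Re x - Re y \<le> d"
        using norm_triangle_ineq2[of y x] complex_Re_le_cmod[of "x - y"]
        by (auto simp: R_def norm_minus_commute)
      then have "norm (y + 1) \<le> R + 1" using norm_triangle_ineq[of y 1] by simp
      have "norm (trapezoid_error (real (Suc n)) y)
              \<le> norm y * norm (y + 1) / 2 * real (Suc n) powr (- Re y - 2)"
        by (rule norm_trapezoid_error_le) (use y in \<open>auto simp: S_def\<close>)
      also have "\<dots> \<le> R * (R + 1) / 2 * real (Suc n) powr (- 1 - d)"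
        using ny \<open>norm (y + 1) \<le> R + 1\<close> R
        by (intro mult_mono divide_right_mono powr_mono) (auto simp: d_def field_simps)
      also have "\<dots> = norm (h n)" using R unfolding h_def norm_of_real by simp
      finally show ?thesis .
    qed
    ultimately show "\<exists>d h. 0 < d \<and> summable h \<and> range h \<subseteq> \<real>\<^sub>\<ge>\<^sub>0 \<and>
        (\<forall>\<^sub>F n in sequentially. \<forall>y\<in>ball x d \<inter> S. cmod (trapezoid_error (real (Suc n)) y) \<le> cmod (h n))"
      using d by (intro exI[of _ d] exI[of _ h]) auto
  qed
  show "\<And>s. -1 < Re s \<Longrightarrow> s \<noteq> 1 \<Longrightarrow> summable (\<lambda>n. trapezoid_error (real (Suc n)) s)"
    using g by (auto simp: S_def sums_iff)
  have "g holomorphic_on S"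
    using g by (auto simp: holomorphic_on_def intro: field_differentiable_at_within)
  then have "(\<lambda>s. 1 / 2 + 1 / (s - 1) + g s) holomorphic_on S"
    by (intro holomorphic_intros) (auto simp: S_def)
  then have "zeta_aux holomorphic_on S"
    by (rule holomorphic_transform) (use g in \<open>auto simp: zeta_aux_def sums_iff\<close>)
  then show "zeta_aux holomorphic_on {z. -1 < Re z} - {1}" by (simp add: S_def)
qed

lemma zeta_aux_sums:
  assumes s: "1 < Re s"
  shows "(\<lambda>n. 1 / of_nat (Suc n) powr s) sums zeta_aux s"
proof -
  have s1: "s \<noteq> 1" using s by auto
  let ?T = "\<lambda>n. trapezoid_error (real (Suc n)) s"
  \<comment> \<open>The trapezoids count both ends, 1 and N + 1, half, which leaves the two halved
    terms; the integrals telescope to the one from 1 to N + 1. Both powers of N + 1 tend to 0 when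
    Re s > 1.\<close>
  have part: "(\<Sum>n<N. 1 / of_nat (Suc n) powr s) =
      (\<Sum>n<N. ?T n) + 1 / 2 - of_nat (Suc N) powr (- s) / 2
        + (of_nat (Suc N) powr (1 - s) - 1) / (1 - s)" for N
  proof (induction N)
    case (Suc N)
    have "?T N = (1 / of_nat (Suc N) powr s + of_nat (Suc (Suc N)) powr (- s)) / 2
      - (of_nat (Suc (Suc N)) powr (1 - s) - of_nat (Suc N) powr (1 - s)) / (1 - s)"
      by (simp add: trapezoid_error_def powr_minus_divide add_ac)
    then show ?case
      by (simp add: Suc powr_minus_divide diff_divide_distrib add_divide_distrib del: of_nat_Suc)
  qed simp
  have lim: "(\<lambda>N. of_nat (Suc N) powr w) \<longlonglongrightarrow> (0::complex)" if "Re w < 0" for w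
    by (intro tendsto_neg_powr_complex_of_nat that filterlim_Suc)
  have "(\<lambda>N. (\<Sum>n<N. ?T n) + 1 / 2 - of_nat (Suc N) powr (- s) / 2
        + (of_nat (Suc N) powr (1 - s) - 1) / (1 - s))
      \<longlonglongrightarrow> suminf ?T + 1 / 2 - 0 / 2 + (0 - 1) / (1 - s)"
    by (intro tendsto_intros lim summable_LIMSEQ trapezoid_error_series) (use s s1 in auto)
  also have "suminf ?T + 1 / 2 - 0 / 2 + (0 - 1) / (1 - s) = zeta_aux s"
    using s1 minus_divide_right[of 1 "1 - s"] by (simp add: zeta_aux_def)
  finally show ?thesis unfolding sums_def part .
qed

lemma zeta_eq_zeta_aux:
  assumes "-1 < Re s" "s \<noteq> 1"
  shows "zeta s = zeta_aux s"
  using assms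
  by (intro zeta_eqI[of "-1"])
     (auto simp: zeta_continuation_def simp del: of_nat_Suc intro: trapezoid_error_series zeta_aux_sums)

section \<open>Sign of zeta on the real interval (-1, 1)\<close>

lemma trapezoid_error_of_real:
  assumes "0 \<le> a"
  shows "trapezoid_error a (of_real s) = of_real
     ((a powr (- s) + (a + 1) powr (- s)) / 2 - ((a + 1) powr (1 - s) - a powr (1 - s)) / (1 - s))"
proof -
  have "complex_of_real x powr (- of_real s) = of_real (x powr (- s))"
    "complex_of_real x powr (1 - of_real s) = of_real (x powr (1 - s))" if "0 \<le> x" for x
    using that powr_of_real[of x "-s"] powr_of_real[of x "1-s"] by simp_all
  from this[of a] this[of "a + 1"] assms show ?thesis
    by (simp add: trapezoid_error_def)
qed

text \<open>The trapezoid lies below the graph of the concave function \<open>x powr (- s)\<close>.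
  In terms of the error as a function of the right endpoint, \<open>f''\<close> carries the factor
  \<open>s * (s + 1) \<le> 0\<close>, and \<open>f'\<close> and \<open>f\<close> start from 0 at
  \<open>a\<close>.\<close>

lemma trapezoid_error_nonpos:
  assumes a: "0 < a" and s: "-1 < s" "s \<le> 0"
  shows "Re (trapezoid_error a (of_real s)) \<le> 0"
proof -
  define f where
    "f x = (x - a) * (a powr (- s) + x powr (- s)) / 2 - (x powr (1 - s) - a powr (1 - s)) / (1 - s)" for x
  define f' where "f' x = (a powr (- s) - x powr (- s)) / 2 + (x - a) * (- s * x powr (- s - 1)) / 2" for x
  have dF: "((\<lambda>x. (x powr (1 - s) - a powr (1 - s)) / (1 - s)) has_real_derivative x powr (- s)) (at x)"
    if "a \<le> x" for x
    using DERIV_cdivide[where c = "1 - s",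
        OF DERIV_diff[OF has_real_derivative_powr[of x "1 - s"] DERIV_const[of "a powr (1 - s)"]]]
      a s that by simp
  have df: "(f has_real_derivative f' x) (at x)" if "a \<le> x" for x
  proof -
    have "((\<lambda>x. (x - a) * (a powr (- s) + x powr (- s)) / 2) has_real_derivative f' x + x powr (- s)) (at x)"
      unfolding f'_def using a that
      by (auto intro!: derivative_eq_intros has_real_derivative_powr simp: field_simps)
    from DERIV_diff[OF this dF[OF that]] show ?thesis unfolding f_def by simp
  qed
  have df': "(f' has_real_derivative (x - a) * (s * (s + 1) * x powr (- s - 2)) / 2) (at x)" if "a \<le> x" for x
    unfolding f'_def using a s that
    by (auto intro!: derivative_eq_intros has_real_derivative_powr simp: field_simps)
  have neg: "(x - a) * (s * (s + 1) * x powr (- s - 2)) / 2 \<le> 0" if "a \<le> x" for x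
  proof -
    have "s * (s + 1) * x powr (- s - 2) \<le> 0"
      using s by (intro mult_nonpos_nonneg) auto
    then show ?thesis using that by (simp add: mult_nonneg_nonpos)
  qed
  have "f' x \<le> f' a" if "a \<le> x" for x
  proof (rule DERIV_nonpos_imp_nonincreasing[OF that])
    fix y assume "a \<le> y"
    from df'[OF this] neg[OF this] show "\<exists>d. (f' has_real_derivative d) (at y) \<and> d \<le> 0"
      by (intro exI conjI)
  qed
  then have neg': "f' x \<le> 0" if "a \<le> x" for x using that by (simp add: f'_def)
  have "f (a + 1) \<le> f a"
  proof (rule DERIV_nonpos_imp_nonincreasing[where f = f and a = a and b = "a + 1"])
    fix y assume "a \<le> y"
    from df[OF this] neg'[OF this] show "\<exists>d. (f has_real_derivative d) (at y) \<and> d \<le> 0"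
      by (intro exI conjI)
  qed simp
  then show ?thesis
    using a by (simp add: trapezoid_error_of_real f_def)
qed

text \<open>The integrand decreases, so its integral over the unit interval, which equals
  \<open>z powr (- s)\<close> for some z inside, is at least the value at the right end. Half the
  drop of the integrand remains.\<close>

lemma trapezoid_error_le:
  assumes a: "0 < a" and s: "0 \<le> s" "s < 1"
  shows "Re (trapezoid_error a (of_real s)) \<le> (a powr (- s) - (a + 1) powr (- s)) / 2"
proof -
  have "\<exists>z>a. z < a + 1 \<and> (a + 1) powr (1 - s) / (1 - s) - a powr (1 - s) / (1 - s) = (a + 1 - a) * z powr (- s)"
    using a s by (intro MVT2) (auto intro!: derivative_eq_intros has_real_derivative_powr)
  then obtain z where z: "a < z" "z < a + 1"
    and eq: "(a + 1) powr (1 - s) / (1 - s) - a powr (1 - s) / (1 - s) = z powr (- s)" by auto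
  have "(a + 1) powr (- s) \<le> z powr (- s)"
    using a s z by (intro powr_mono2') auto
  then show ?thesis using a eq by (simp add: trapezoid_error_of_real diff_divide_distrib add_divide_distrib)
qed

lemma zeta_nonpos:
  assumes s: "-1 < s" "s < 1"
  shows "Re (zeta (of_real s)) \<le> 0"
proof -
  let ?T = "\<lambda>n. trapezoid_error (real (Suc n)) (of_real s)"
  have summ: "summable ?T" by (intro trapezoid_error_series) (use s in auto)
  have "Re (zeta (of_real s)) = Re (zeta_aux (of_real s))"
    using s by (subst zeta_eq_zeta_aux) auto
  also have "\<dots> = 1 / 2 + 1 / (s - 1) + (\<Sum>n. Re (?T n))"
  proof -
    have "1 / (complex_of_real s - 1) = of_real (1 / (s - 1))" by simp
    then show ?thesis unfolding zeta_aux_def by (simp only: Re_suminf[OF summ, symmetric] plus_complex.sel) simp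
  qed
  also have "\<dots> \<le> 0"
  proof (cases "s \<le> 0")
    case True
    have "(\<Sum>n. Re (?T n)) \<le> (\<Sum>n. 0::real)"
      by (intro suminf_le summable_Re summ trapezoid_error_nonpos) (use s True in auto)
    \<comment> \<open>Here \<open>- 2 < s - 1 < 0\<close>, so \<open>1 / (s - 1)\<close> is below
      -1/2.\<close>
    moreover have "1 / 2 + 1 / (s - 1) \<le> 0" using s by (simp add: field_simps)
    ultimately show ?thesis by simp
  next
    case False
    have "(\<Sum>n. Re (?T n)) \<le> 1 / 2"
    proof (rule suminf_le_const[OF summable_Re[OF summ]])
      fix N
      have "(\<Sum>n<N. Re (?T n)) \<le> (\<Sum>n<N. (real (Suc n) powr (- s) - real (Suc (Suc n)) powr (- s)) / 2)"
        using trapezoid_error_le[of "real (Suc _)" s] s False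
        by (intro sum_mono) (simp add: add_ac)
      also have "\<dots> = (1 - real (Suc N) powr (- s)) / 2"
        by (induction N) (auto simp: field_simps)
      also have "\<dots> \<le> 1 / 2" by simp
      finally show "(\<Sum>n<N. Re (?T n)) \<le> 1 / 2" .
    qed
    \<comment> \<open>The telescoped bound 1/2 raises the constant to 1, and
      \<open>1 + 1 / (s - 1) = s / (s - 1)\<close>.\<close>
    moreover have "1 + 1 / (s - 1) \<le> 0" using s False by (simp add: field_simps)
    ultimately show ?thesis by simp
  qed
  finally show ?thesis .
qed

section \<open>Quadrature sums and the discrete maximum principle\<close>

text \<open>The second summand is the integral of \<open>x powr (- 1 - \<alpha>)\<close> from m to
  infinity. Passing to m + 1 trades the integral over \<open>[m, m + 1]\<close> for the smaller
  value at m + 1, so the left side decreases from its value at m = 1, which is the right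
  side.\<close>

lemma sum_powr_le:
  assumes "0 < \<alpha>" "1 \<le> (m::nat)"
  shows "(\<Sum>k=1..m. 1 / real k powr (1 + \<alpha>)) + 1 / (\<alpha> * real m powr \<alpha>) \<le> 1 + 1 / \<alpha>"
  using assms(2)
proof (induction m rule: dec_induct)
  case (step m)
  have m: "0 < real m" using step by simp
  have "\<exists>z>real m. z < real (Suc m) \<and> - (1 / \<alpha>) * real (Suc m) powr (- \<alpha>) - - (1 / \<alpha>) * real m powr (- \<alpha>)
      = (real (Suc m) - real m) * z powr (- \<alpha> - 1)"
    using m assms(1) by (intro MVT2) (auto intro!: derivative_eq_intros has_real_derivative_powr)
  then obtain z where z: "real m < z" "z < real (Suc m)"
    and eq: "- (1 / \<alpha>) * real (Suc m) powr (- \<alpha>) - - (1 / \<alpha>) * real m powr (- \<alpha>) = z powr (- \<alpha> - 1)"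
    by auto
  have "real (Suc m) powr (- \<alpha> - 1) \<le> z powr (- \<alpha> - 1)"
    using z m assms(1) by (intro powr_mono2') auto
  moreover have "1 / real (Suc m) powr (1 + \<alpha>) = real (Suc m) powr (- \<alpha> - 1)"
  proof -
    have "- \<alpha> - 1 = - (1 + \<alpha>)" by simp
    then show ?thesis by (simp only: powr_minus_divide)
  qed
  ultimately have "1 / real (Suc m) powr (1 + \<alpha>) + 1 / (\<alpha> * real (Suc m) powr \<alpha>)
      \<le> 1 / (\<alpha> * real m powr \<alpha>)"
    using eq by (simp add: powr_minus_divide del: of_nat_Suc)
  then show ?case using step by simp
qed simp

lemma sum_symmetric_int_interval:
  fixes f :: "int \<Rightarrow> real"
  shows "(\<Sum>k\<in>{- int p..int q} - {0}. f k) = (\<Sum>k=1..p. f (- int k)) + (\<Sum>k=1..q. f (int k))"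
proof -
  have "{- int p..int q} - {0} = {- int p..-1} \<union> {1..int q}" by auto
  then have "(\<Sum>k\<in>{- int p..int q} - {0}. f k) = (\<Sum>k\<in>{- int p..-1}. f k) + (\<Sum>k\<in>{1..int q}. f k)"
    by (simp add: sum.union_disjoint)
  also have "(\<Sum>k\<in>{- int p..-1}. f k) = (\<Sum>k=1..p. f (- int k))"
    by (rule sum.reindex_bij_witness[of _ "\<lambda>k. - int k" "\<lambda>k. nat (- k)"]) auto
  also have "(\<Sum>k\<in>{1..int q}. f k) = (\<Sum>k=1..q. f (int k))"
    by (rule sum.reindex_bij_witness[of _ int nat]) auto
  finally show ?thesis .
qed

lemma c1_pos:
  assumes "0 < \<alpha>" "\<alpha> < 2"
  shows "0 < c1 \<alpha>"
  unfolding c1_def using assms by (intro divide_pos_pos mult_pos_pos Gamma_real_pos) auto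

theorem proposition3p1:
  fixes \<alpha> Mt dt h M :: real and \<sigma> :: "real \<Rightarrow> real" and J n :: nat
    and U :: "nat \<Rightarrow> int \<Rightarrow> real"
  assumes "0 < \<alpha>" and "\<alpha> < 2"
    and "C2 (\<lambda>x. \<bar>\<sigma> x\<bar> powr \<alpha>)"
    and "\<And>x. \<sigma> x \<noteq> 0"
    and "\<And>x. \<bar>\<sigma> x\<bar> \<le> Mt"
    and "1 \<le> J" and "h = 1 / real J" and "0 < dt"
    and "euler_scheme \<alpha> \<sigma> J dt U"
    and "dt / h powr \<alpha>
           \<le> 1 / (2 * Mt powr \<alpha> * c1 \<alpha> * (1 + 1 / \<alpha> - Re (zeta (of_real (\<alpha> - 1)))))"
    and "M = Max (U 0 ` {j. \<bar>j\<bar> < int J})"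
    and "\<And>j. \<bar>j\<bar> < int J \<Longrightarrow> 0 < U n j \<and> U n j \<le> M"
  shows "\<forall>j. \<bar>j\<bar> < int J \<longrightarrow> U (Suc n) j \<le> M"
proof (intro allI impI)
  fix j :: int
  assume j: "\<bar>j\<bar> < int J"
  define Z where "Z = - Re (zeta (of_real (\<alpha> - 1)))"
  define x where "x k = of_int k * h" for k :: int
  define c where "c = c1 \<alpha> * \<bar>\<sigma> (x j)\<bar> powr \<alpha>"
  \<comment> \<open>\<open>p\<close> and \<open>q\<close> are the distances from the grid point to
    -1 and 1 in steps of h: the sum runs from \<open>- p\<close> to \<open>q\<close>, and
    \<open>1 + x j = p * h\<close>, \<open>1 - x j = q * h\<close>.\<close>
  define p where "p = nat (int J + j)"
  define q where "q = nat (int J - j)"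
  have pq: "1 \<le> p" "1 \<le> q" "int p = int J + j" "int q = int J - j"
    using j by (auto simp: p_def q_def)
  have rpq: "real p = real J + of_int j" "real q = real J - of_int j"
    using pq(3,4) by linarith+
  have h: "0 < h" "real J * h = 1" using assms(6,7) by auto
  have Z: "0 \<le> Z" using zeta_nonpos[of "\<alpha> - 1"] assms(1,2) by (simp add: Z_def)
  have Mt: "0 < Mt" using assms(4,5)[of 0] by linarith
  have c: "0 \<le> c" "c \<le> c1 \<alpha> * Mt powr \<alpha>"
    using c1_pos[of \<alpha>] assms(1,2,5) by (auto simp: c_def intro!: mult_left_mono powr_mono2)
  have "0 < M" using assms(12)[of 0] assms(6) by auto
  \<comment> \<open>Outside the interior the values are 0, which lies below M because M bounds the
    positive value at index 0.\<close>
  then have U_le: "U n i \<le> M" for i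
    using assms(9) assms(12)[of i] by (cases "\<bar>i\<bar> < int J") (auto simp: euler_scheme_def Let_def)
  have Uj: "0 < U n j" "U n j \<le> M" using assms(12)[OF j] by auto
  \<comment> \<open>\<open>H p\<close> and \<open>H q\<close> collect, for the left and the right
    side, the quadrature sum and the absorption term, both freed of the common factor
    \<open>h powr (- \<alpha>)\<close>.\<close>
  define H where "H m = (\<Sum>k=1..m. 1 / real k powr (1 + \<alpha>)) + 1 / (\<alpha> * real m powr \<alpha>)" for m
  define Q where "Q = (\<Sum>k \<in> {- int J - j .. int J - j} - {0}.
                     end_weight J j k * ((U n (j + k) - U n j) / \<bar>x k\<bar> powr (1 + \<alpha>)))"
  define P where "P = 1 / (1 + x j) powr \<alpha> + 1 / (1 - x j) powr \<alpha>"
  have step: "U (Suc n) j = U n j + dt * c * (h powr (- \<alpha>) * Z * (U n (j + 1) - 2 * U n j + U n (j - 1))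
      - 1 / \<alpha> * P * U n j + h * Q)"
  proof -
    have "U (Suc n) j = U n j - dt * c * (- Z) * h powr (- \<alpha>) * (U n (j + 1) - 2 * U n j + U n (j - 1))
        - c * dt / \<alpha> * P * U n j + c * dt * h * Q"
      using assms(9) j
      unfolding euler_scheme_def Let_def c_def Z_def Q_def P_def x_def assms(7) minus_minus by blast
    then show ?thesis by (simp add: algebra_simps)
  qed
  \<comment> \<open>Each neighbour is raised to M. As \<open>M - U n j\<close> is nonnegative, the
    halved end weights may then be raised to 1.\<close>
  have "Q \<le> (\<Sum>k \<in> {- int p .. int q} - {0}. (M - U n j) * (1 / \<bar>x k\<bar> powr (1 + \<alpha>)))"
  proof -
    have "end_weight J j k * ((U n (j + k) - U n j) / \<bar>x k\<bar> powr (1 + \<alpha>))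
        \<le> 1 * ((M - U n j) / \<bar>x k\<bar> powr (1 + \<alpha>))" for k
    proof -
      have "(U n (j + k) - U n j) / \<bar>x k\<bar> powr (1 + \<alpha>) \<le> (M - U n j) / \<bar>x k\<bar> powr (1 + \<alpha>)"
        by (intro divide_right_mono) (use U_le in auto)
      then have "end_weight J j k * ((U n (j + k) - U n j) / \<bar>x k\<bar> powr (1 + \<alpha>))
          \<le> end_weight J j k * ((M - U n j) / \<bar>x k\<bar> powr (1 + \<alpha>))"
        by (intro mult_left_mono) (auto simp: end_weight_def)
      also have "\<dots> \<le> 1 * ((M - U n j) / \<bar>x k\<bar> powr (1 + \<alpha>))"
        using Uj by (intro mult_right_mono divide_nonneg_nonneg) (auto simp: end_weight_def)
      finally show ?thesis .
    qed
    then show ?thesis unfolding Q_def pq(3,4) by (auto intro!: sum_mono)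
  qed
  also have "\<dots> = (M - U n j) * (\<Sum>k \<in> {- int p .. int q} - {0}. 1 / \<bar>x k\<bar> powr (1 + \<alpha>))"
    by (simp only: sum_distrib_left)
  also have "(\<Sum>k \<in> {- int p .. int q} - {0}. 1 / \<bar>x k\<bar> powr (1 + \<alpha>))
      = h powr (- 1 - \<alpha>) * ((\<Sum>k=1..p. 1 / real k powr (1 + \<alpha>)) + (\<Sum>k=1..q. 1 / real k powr (1 + \<alpha>)))"
  proof -
    have "1 / \<bar>x (int k)\<bar> powr (1 + \<alpha>) = h powr (- 1 - \<alpha>) * (1 / real k powr (1 + \<alpha>))"
      "1 / \<bar>x (- int k)\<bar> powr (1 + \<alpha>) = h powr (- 1 - \<alpha>) * (1 / real k powr (1 + \<alpha>))" for k
      using h powr_minus_divide[of h "1 + \<alpha>"] by (simp_all add: x_def abs_mult powr_mult)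
    then show ?thesis
      by (simp only: sum_symmetric_int_interval sum_distrib_left distrib_left)
  qed
  finally have Q: "h * Q \<le> h * ((M - U n j) * (h powr (- 1 - \<alpha>) *
      ((\<Sum>k=1..p. 1 / real k powr (1 + \<alpha>)) + (\<Sum>k=1..q. 1 / real k powr (1 + \<alpha>)))))"
    using h by (intro mult_left_mono) auto
  have hh: "h * h powr (- 1 - \<alpha>) = h powr (- \<alpha>)"
    using h powr_add[of h 1 "- 1 - \<alpha>"] by simp
  have P: "P = h powr (- \<alpha>) * (1 / real p powr \<alpha> + 1 / real q powr \<alpha>)"
  proof -
    have "1 + x j = real p * h" "1 - x j = real q * h"
      using h by (simp_all add: x_def rpq algebra_simps)
    then show ?thesis
      unfolding P_def using h by (simp add: powr_mult powr_minus_divide distrib_left mult.commute)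
  qed
  \<comment> \<open>Absorption acts like jumps to the exterior value 0; raising that value to M
    gives the same factor \<open>M - U n j\<close> as in the other terms.\<close>
  have "- 1 / \<alpha> * P * U n j \<le> (M - U n j) * (1 / \<alpha> * P)"
  proof -
    have "0 \<le> 1 / \<alpha> * P * M" using assms(1) \<open>0 < M\<close> by (auto simp: P_def)
    then show ?thesis by (simp add: algebra_simps)
  qed
  moreover have "h powr (- \<alpha>) * Z * (U n (j + 1) - 2 * U n j + U n (j - 1))
      \<le> h powr (- \<alpha>) * Z * (2 * (M - U n j))"
    using U_le[of "j + 1"] U_le[of "j - 1"] Z by (intro mult_left_mono) auto
  ultimately have "h powr (- \<alpha>) * Z * (U n (j + 1) - 2 * U n j + U n (j - 1)) - 1 / \<alpha> * P * U n j + h * Q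
      \<le> h powr (- \<alpha>) * Z * (2 * (M - U n j)) + (M - U n j) * (1 / \<alpha> * P)
        + h * ((M - U n j) * (h powr (- 1 - \<alpha>) *
      ((\<Sum>k=1..p. 1 / real k powr (1 + \<alpha>)) + (\<Sum>k=1..q. 1 / real k powr (1 + \<alpha>)))))"
    using Q by simp
  also have "\<dots> = (M - U n j) * (h powr (- \<alpha>) * (2 * Z + H p + H q))"
    unfolding H_def P hh[symmetric] by (simp add: algebra_simps)
  finally have "U (Suc n) j \<le> U n j + dt * c * ((M - U n j) * (h powr (- \<alpha>) * (2 * Z + H p + H q)))"
    unfolding step using assms(8) c by (intro add_left_mono mult_left_mono) auto
  also have "\<dots> = U n j + (M - U n j) * (dt * c * (h powr (- \<alpha>) * (2 * Z + H p + H q)))"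
    by simp
  \<comment> \<open>It remains to bound the coefficient of \<open>M - U n j\<close> by 1. The second
    difference contributes \<open>2 * Z\<close>, and each of the two sides at most
    \<open>1 + 1 / \<alpha>\<close>: this is the factor 2 and the bracket of the step size
    condition, while \<open>Mt\<close> bounds \<sigma>.\<close>
  also have "\<dots> \<le> U n j + (M - U n j) * 1"
  proof -
    have "H p \<le> 1 + 1 / \<alpha>" "H q \<le> 1 + 1 / \<alpha>"
      unfolding H_def using pq assms(1) by (intro sum_powr_le; simp)+
    moreover define W where "W = 1 + 1 / \<alpha> + Z"
    ultimately have "2 * Z + H p + H q \<le> 2 * W" by simp
    moreover have "0 \<le> H m" for m
      using assms(1) by (auto simp: H_def intro!: add_nonneg_nonneg sum_nonneg)
    moreover have c1: "0 < c1 \<alpha>" by (rule c1_pos[OF assms(1,2)])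
    ultimately have "dt * c * (h powr (- \<alpha>) * (2 * Z + H p + H q))
        \<le> dt * (c1 \<alpha> * Mt powr \<alpha>) * (h powr (- \<alpha>) * (2 * W))"
      using assms(8) c Z by (intro mult_mono mult_nonneg_nonneg add_nonneg_nonneg) auto
    also have "\<dots> = dt / h powr \<alpha> * (2 * Mt powr \<alpha> * c1 \<alpha> * W)"
      by (simp only: powr_minus_divide[of h] times_divide_eq_left times_divide_eq_right mult_1 ac_simps)
    also have "\<dots> \<le> 1"
    proof -
      have "0 < W" unfolding W_def
        using Z assms(1) by (intro add_pos_nonneg) auto
      then have "0 < 2 * Mt powr \<alpha> * c1 \<alpha> * W"
        using Mt c1 by (intro mult_pos_pos) auto
      moreover have "dt / h powr \<alpha> \<le> 1 / (2 * Mt powr \<alpha> * c1 \<alpha> * W)"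
        using assms(10) by (simp add: Z_def W_def)
      ultimately show ?thesis by (simp only: pos_le_divide_eq)
    qed
    finally show ?thesis using Uj by (intro add_left_mono mult_left_mono) auto
  qed
  finally show "U (Suc n) j \<le> M" by simp
qed

end
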